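(* Let $k,a\ge 1$ be odd integers such that every prime divisor $p$ of $k$ or of $a$ satisfies $p\equiv 1\pmod 4$, and let $u,t,s,r\in\mathbb{Z}$. Let $a_{ij}$ be integers satisfying $a_{11}=a_{21}=a_{31}$, $a_{12}=a_{22}$, $a_{13}=a_{23}=a_{33}$, $a_{41}=a_{51}=a_{61}$, $a_{42}=a_{52}$, $a_{43}=a_{53}=a_{63}$, and consider the system of linear equations $$\begin{pmatrix} a_{11}&-a_{12}&a_{13}&-a_{14}\\ a_{21}&-a_{22}&a_{23}&0\\ -3a_{31}&0&a_{33}&0\\ a_{41}&-a_{42}&a_{43}&-a_{44}\\ a_{51}&-a_{52}&a_{53}&0\\ -3a_{61}&0&a_{63}&0\end{pmatrix}\begin{pmatrix} c_1\\ c_2\\ c_3\\ c_4\end{pmatrix}=\begin{pmatrix} k^2\\ 4u-1\\ 4t-1\\ a^2\\ 4s-1\\ 4r-1\end{pmatrix}.$$ Let $s_1,\dots,s_N\in\mathbb{Z}^4$ be integer solutions of this system. For each $i$, writing $s_i=(c_1,c_2,c_3,c_4)$, consider the curves $$E_{s_i}: Y^2=a_{11}c_1X^3+a_{12}c_2X^2+a_{13}c_3X+a_{14}c_4,$$ $$C_{s_i}: Y^2=a_{41}c_1X^3+a_{42}c_2X^2+a_{43}c_3X+a_{44}c_4.$$ Then for every $i=1,\dots,N$, neither $E_{s_i}$ nor $C_{s_i}$ has a point $(x,y)$ with integer coordinates $x>1$, $y\ge 1$.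
   Context: The curves are the affine curves given by the displayed equations; no nonsingularity is required. The condition on prime divisors is vacuous for $k=1$ or $a=1$. *)

theory Defs
  imports
    "HOL-Analysis.Analysis"
    "HOL-Computational_Algebra.Primes"
    "HOL-Number_Theory.Cong"
begin

text \<open>
  The family \<open>A i j\<close> of integers is indexed from 1 on; only the entries occurring in
  \<open>coefficient_matrix\<close> are ever used. In the index types \<open>4\<close> and \<open>6\<close> the literals
  \<open>4\<close> and \<open>6\<close> denote the same elements as \<open>0\<close>, so \<open>c $ 1\<close>, ..., \<open>c $ 4\<close> are the four
  distinct components of \<open>c :: int ^ 4\<close>.
\<close>

definition coefficient_matrix :: "(nat \<Rightarrow> nat \<Rightarrow> int) \<Rightarrow> int ^ 4 ^ 6" where
  "coefficient_matrix A = vector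
     [vector [A 1 1,      - A 1 2, A 1 3, - A 1 4],
      vector [A 2 1,      - A 2 2, A 2 3, 0],
      vector [- 3 * A 3 1, 0,      A 3 3, 0],
      vector [A 4 1,      - A 4 2, A 4 3, - A 4 4],
      vector [A 5 1,      - A 5 2, A 5 3, 0],
      vector [- 3 * A 6 1, 0,      A 6 3, 0]]"

definition right_hand_side :: "int \<Rightarrow> int \<Rightarrow> int \<Rightarrow> int \<Rightarrow> int \<Rightarrow> int \<Rightarrow> int ^ 6" where
  "right_hand_side k a u t s r =
     vector [k ^ 2, 4 * u - 1, 4 * t - 1, a ^ 2, 4 * s - 1, 4 * r - 1]"

text \<open>The affine curve \<open>Y\<^sup>2 = b3 X\<^sup>3 + b2 X\<^sup>2 + b1 X + b0\<close>, as its set of complex points;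
  it may be singular, and \<open>b3\<close> may vanish.\<close>

definition affine_cubic_curve :: "int \<Rightarrow> int \<Rightarrow> int \<Rightarrow> int \<Rightarrow> (complex \<times> complex) set" where
  "affine_cubic_curve b3 b2 b1 b0 =
     {(X, Y). Y ^ 2 = of_int b3 * X ^ 3 + of_int b2 * X ^ 2 + of_int b1 * X + of_int b0}"

definition curve_E :: "(nat \<Rightarrow> nat \<Rightarrow> int) \<Rightarrow> int ^ 4 \<Rightarrow> (complex \<times> complex) set" where
  "curve_E A c =
     affine_cubic_curve (A 1 1 * c $ 1) (A 1 2 * c $ 2) (A 1 3 * c $ 3) (A 1 4 * c $ 4)"

definition curve_C :: "(nat \<Rightarrow> nat \<Rightarrow> int) \<Rightarrow> int ^ 4 \<Rightarrow> (complex \<times> complex) set" where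
  "curve_C A c =
     affine_cubic_curve (A 4 1 * c $ 1) (A 4 2 * c $ 2) (A 4 3 * c $ 3) (A 4 4 * c $ 4)"

end

theory Submission
  imports Defs "HOL-Number_Theory.Residues"
begin

text \<open>
  Both halves of the system have the same shape, so consider one cubic
  \<open>f(x) = b3 x\<^sup>3 + b2 x\<^sup>2 + b1 x + b0\<close>. The first equation of its half says
  \<open>f(-1) = -k\<^sup>2\<close>. An integer point on \<open>Y\<^sup>2 = f(X)\<close> therefore gives
  \<open>y\<^sup>2 + k\<^sup>2 = f(x) - f(-1) = (x + 1) q(x)\<close> with an integer quadratic \<open>q\<close>.

  The other two equations fix \<open>f\<close> modulo 4 up to the coefficient \<open>b3\<close>, namely
  \<open>f(x) \<equiv> b3 (x\<^sup>3 - x) - x + 2\<close>. For \<open>x \<equiv> 0\<close> or \<open>x \<equiv> 3\<close> the value is 2 or 3, which is not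
  a square modulo 4. For \<open>x \<equiv> 2\<close> the factor \<open>x + 1\<close> is 3 modulo 4, and for \<open>x \<equiv> 1\<close> the
  factor \<open>q(x)\<close> is. Both factors are positive when \<open>x > -1\<close>, so in these cases
  \<open>y\<^sup>2 + k\<^sup>2\<close> has a positive divisor that is 3 modulo 4, hence a prime divisor
  \<open>p \<equiv> 3\<close> (\<open>ex_prime_factor_3_mod_4\<close>). As \<open>-1\<close> is not a square modulo such a prime, \<open>p\<close>
  divides \<open>k\<close> (\<open>prime_3_mod_4_dvd_sum_two_squares\<close>), contrary to the assumption on \<open>k\<close>.
\<close>

section \<open>Divisors of a sum of two squares\<close>

lemma ex_prime_factor_3_mod_4:
  fixes d :: nat
  assumes "d mod 4 = 3"
  shows "\<exists>p. prime p \<and> p dvd d \<and> p mod 4 = 3"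
  using assms
proof (induction d rule: less_induct)
  case (less d)
  from less.prems have "d \<noteq> 1" by auto
  then obtain p where p: "prime p" "p dvd d" using prime_factor_nat by blast
  then obtain q where d: "d = p * q" by blast
  show ?case
  proof (cases "p mod 4 = 3")
    case True
    then show ?thesis using p by blast
  next
    case False
    have "odd d" using less.prems by presburger
    then have "odd p" using d by simp
    with False have "p mod 4 = 1" by presburger
    then have "q mod 4 = 3"
      using less.prems d by (metis mod_mult_left_eq mult_1)
    moreover have "q < d"
      using d prime_gt_1_nat[OF p(1)] \<open>q mod 4 = 3\<close> by (cases "q = 0") auto
    ultimately show ?thesis using less.IH[of q] d by auto
  qed
qed

text \<open>
  Write \<open>p - 1 = 2 e\<close> with \<open>e\<close> odd. Raising \<open>m\<^sup>2 \<equiv> -n\<^sup>2\<close> to the power \<open>e\<close> gives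
  \<open>m ^ (p - 1) \<equiv> -n ^ (p - 1)\<close>, which by Fermat's little theorem reads \<open>1 \<equiv> -1\<close> unless
  \<open>p\<close> divides \<open>m\<close> and \<open>n\<close>.
\<close>

lemma prime_3_mod_4_dvd_sum_two_squares:
  fixes p m n :: nat
  assumes p: "prime p" "p mod 4 = 3" and dvd: "p dvd m ^ 2 + n ^ 2"
  shows "p dvd n"
proof (rule ccontr)
  assume n: "\<not> p dvd n"
  have m: "\<not> p dvd m"
  proof
    assume "p dvd m"
    then have "p dvd m ^ 2" by (simp add: power2_eq_square)
    then have "p dvd n ^ 2" using dvd by (simp add: dvd_add_right_iff)
    then show False using n p(1) prime_dvd_power by blast
  qed
  define e where "e = (p - 1) div 2"
  have pe: "p - 1 = 2 * e" and "odd e"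
    using p(2) unfolding e_def by presburger+
  have "int p dvd int m ^ 2 + int n ^ 2"
    using dvd by (metis of_nat_add of_nat_dvd_iff of_nat_power)
  then have "[int m ^ 2 = - (int n ^ 2)] (mod int p)"
    by (simp add: cong_iff_dvd_diff)
  then have "[(int m ^ 2) ^ e = (- (int n ^ 2)) ^ e] (mod int p)"
    by (rule cong_pow)
  then have neg: "[int m ^ (p - 1) = - (int n ^ (p - 1))] (mod int p)"
    using \<open>odd e\<close> unfolding pe power_mult by simp
  have fermat: "[int l ^ (p - 1) = 1] (mod int p)" if "\<not> p dvd l" for l
    using fermat_theorem[OF p(1) that] by (metis cong_int_iff of_nat_1 of_nat_power)
  have "[1 = - (1::int)] (mod int p)"
    using cong_trans[OF cong_sym[OF fermat[OF m]] cong_trans[OF neg]] fermat[OF n]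
    by (simp add: cong_minus_minus_iff)
  then have "int p dvd 2" by (simp add: cong_iff_dvd_diff)
  then have "p dvd 2" using int_dvd_int_iff[of p 2] by simp
  then have "p \<le> 2" by (simp add: dvd_imp_le)
  moreover have "p \<ge> 3" using p(2) by presburger
  ultimately show False by simp
qed

lemma no_divisor_3_mod_4_of_sum_two_squares:
  fixes d k y :: int
  assumes good: "\<And>p :: int. prime p \<Longrightarrow> p dvd k \<Longrightarrow> [p = 1] (mod 4)"
    and d: "d > 0" "d mod 4 = 3"
  shows "\<not> d dvd y ^ 2 + k ^ 2"
proof
  assume dvd: "d dvd y ^ 2 + k ^ 2"
  have "nat d mod 4 = nat (d mod 4)" using d(1) by (simp add: nat_mod_distrib)
  then have "nat d mod 4 = 3" using d(2) by simp
  then obtain p where p: "prime p" "p dvd nat d" "p mod 4 = 3"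
    using ex_prime_factor_3_mod_4 by blast
  have "int p dvd d" using p(2) d(1) int_dvd_int_iff[of p "nat d"] by simp
  then have "int p dvd y ^ 2 + k ^ 2" using dvd by (rule dvd_trans)
  also have "y ^ 2 + k ^ 2 = int (nat \<bar>y\<bar> ^ 2 + nat \<bar>k\<bar> ^ 2)" by simp
  finally have "p dvd nat \<bar>y\<bar> ^ 2 + nat \<bar>k\<bar> ^ 2" by (simp only: int_dvd_int_iff)
  then have "p dvd nat \<bar>k\<bar>" using prime_3_mod_4_dvd_sum_two_squares p by blast
  then have "int p dvd k" using int_dvd_int_iff[of p "nat \<bar>k\<bar>"] by simp
  then have "int p mod 4 = 1" using good[of "int p"] p(1) by (simp add: cong_def)
  moreover have "int p mod 4 = 3" using p(3) by presburger
  ultimately show False by simp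
qed

section \<open>Integer points on one curve\<close>

text \<open>
  The hypotheses are one half of the linear system, with \<open>b3\<close>, \<open>b2\<close>, \<open>b1\<close>, \<open>b0\<close> standing for
  the products of matrix entries and unknowns. The bound on \<open>x\<close> makes the factor \<open>x + 1\<close>
  of \<open>y\<^sup>2 + k\<^sup>2\<close> positive; its cofactor is then positive too, and the residue class of
  \<open>x\<close> modulo 4 decides whether one of the two is 3 modulo 4 or \<open>y\<^sup>2\<close> would be a
  non-square modulo 4.
\<close>

lemma no_integer_point_on_cubic:
  fixes b3 b2 b1 b0 k u t x y :: int
  assumes "odd k"
    and good: "\<And>p :: int. prime p \<Longrightarrow> p dvd k \<Longrightarrow> [p = 1] (mod 4)"
    and eqs: "b3 - b2 + b1 - b0 = k ^ 2" "b3 - b2 + b1 = 4 * u - 1" "- 3 * b3 + b1 = 4 * t - 1"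
    and x: "x > -1"
  shows "y ^ 2 \<noteq> b3 * x ^ 3 + b2 * x ^ 2 + b1 * x + b0"
proof
  assume pt: "y ^ 2 = b3 * x ^ 3 + b2 * x ^ 2 + b1 * x + b0"
  \<comment> \<open>The cofactor of \<open>x + 1\<close> in \<open>f(x) - f(-1)\<close>, obtained by polynomial division.\<close>
  define q where "q = b3 * x ^ 2 + (b2 - b3) * x + (b1 - b2 + b3)"
  have b1: "b1 = 3 * b3 + 4 * t - 1" and b2: "b2 = 4 * b3 + 4 * t - 4 * u"
    and b0: "b0 = 4 * u - 1 - k ^ 2"
    using eqs by linarith+
  have fact: "y ^ 2 + k ^ 2 = (x + 1) * q"
    unfolding pt q_def eqs(1)[symmetric]
    by (simp add: algebra_simps power2_eq_square power3_eq_cube)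
  obtain l where l: "k = 2 * l + 1" using \<open>odd k\<close> by (rule oddE)
  have y_sq: "y ^ 2 mod 4 = 0 \<or> y ^ 2 mod 4 = 1"
  proof (cases "even y")
    case True
    then obtain z where "y = 2 * z" by (rule evenE)
    then have "y ^ 2 = 4 * z ^ 2" by (simp add: power2_eq_square)
    then show ?thesis by simp
  next
    case False
    then obtain z where "y = 2 * z + 1" by (rule oddE)
    then have "y ^ 2 = 4 * (z ^ 2 + z) + 1" by (simp add: power2_eq_square algebra_simps)
    then show ?thesis by presburger
  qed
  have pos: "(x + 1) * q > 0"
  proof -
    have "k ^ 2 > 0" using \<open>odd k\<close> by auto
    then show ?thesis using fact zero_le_power2[of y] by linarith
  qed
  then have "q > 0" using x by (simp add: zero_less_mult_iff)
  define z where "z = x div 4"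
  have "x = 4 * z \<or> x = 4 * z + 1 \<or> x = 4 * z + 2 \<or> x = 4 * z + 3"
    unfolding z_def by presburger
  then consider "x = 4 * z" | "x = 4 * z + 1" | "x = 4 * z + 2" | "x = 4 * z + 3"
    by blast
  then show False
  proof cases
    case 1
    have "y ^ 2 = 4 * (b3 * 16 * z ^ 3 + b2 * 4 * z ^ 2 + b1 * z + u - l ^ 2 - l - 1) + 2"
      unfolding pt b0 l 1 by (simp add: algebra_simps power2_eq_square power3_eq_cube)
    then show False using y_sq by presburger
  next
    case 2
    have "q = 4 * (b3 * (4 * z ^ 2 + 2 * z) + (b2 - b3) * z + b3 + t - 1) + 3"
      unfolding q_def 2 by (simp add: b1 algebra_simps power2_eq_square)
    then have "q mod 4 = 3" by presburger
    moreover have "q dvd y ^ 2 + k ^ 2" using fact by simp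
    ultimately show False
      using no_divisor_3_mod_4_of_sum_two_squares[OF good \<open>q > 0\<close>] by blast
  next
    case 3
    then have "(x + 1) mod 4 = 3" by presburger
    moreover have "x + 1 dvd y ^ 2 + k ^ 2" using fact by simp
    moreover have "x + 1 > 0" using x by simp
    ultimately show False
      using no_divisor_3_mod_4_of_sum_two_squares[OF good] by blast
  next
    case 4
    \<comment> \<open>Here 4 divides \<open>x + 1\<close>, so \<open>y\<^sup>2 \<equiv> -k\<^sup>2 \<equiv> 3\<close> modulo 4.\<close>
    have "y ^ 2 + k ^ 2 = 4 * ((z + 1) * q)"
      unfolding fact 4 by (simp add: algebra_simps)
    moreover have "k ^ 2 = 4 * (l ^ 2 + l) + 1"
      unfolding l by (simp add: algebra_simps power2_eq_square)
    ultimately show False using y_sq by presburger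
  qed
qed

lemma integer_point_on_affine_cubic_curve_iff:
  fixes b3 b2 b1 b0 x y :: int
  shows "(of_int x, of_int y) \<in> affine_cubic_curve b3 b2 b1 b0
    \<longleftrightarrow> y ^ 2 = b3 * x ^ 3 + b2 * x ^ 2 + b1 * x + b0"
proof -
  have "(of_int x, of_int y) \<in> affine_cubic_curve b3 b2 b1 b0
    \<longleftrightarrow> (of_int (y ^ 2) :: complex) = of_int (b3 * x ^ 3 + b2 * x ^ 2 + b1 * x + b0)"
    by (simp add: affine_cubic_curve_def)
  then show ?thesis by (simp only: of_int_eq_iff)
qed

section \<open>The linear system\<close>

lemma vector_4_nth:
  "(vector [x1, x2, x3, x4] :: ('a::zero) ^ 4) $ 1 = x1"
  "(vector [x1, x2, x3, x4] :: ('a::zero) ^ 4) $ 2 = x2"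
  "(vector [x1, x2, x3, x4] :: ('a::zero) ^ 4) $ 3 = x3"
  "(vector [x1, x2, x3, x4] :: ('a::zero) ^ 4) $ 4 = x4"
  by (simp_all add: vector_def)

lemma vector_6_nth:
  "(vector [x1, x2, x3, x4, x5, x6] :: ('a::zero) ^ 6) $ 1 = x1"
  "(vector [x1, x2, x3, x4, x5, x6] :: ('a::zero) ^ 6) $ 2 = x2"
  "(vector [x1, x2, x3, x4, x5, x6] :: ('a::zero) ^ 6) $ 3 = x3"
  "(vector [x1, x2, x3, x4, x5, x6] :: ('a::zero) ^ 6) $ 4 = x4"
  "(vector [x1, x2, x3, x4, x5, x6] :: ('a::zero) ^ 6) $ 5 = x5"
  "(vector [x1, x2, x3, x4, x5, x6] :: ('a::zero) ^ 6) $ 6 = x6"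
  by (simp_all add: vector_def)

lemma linear_system_rows:
  assumes "coefficient_matrix A *v c = right_hand_side k a u t s r"
  shows "A 1 1 * c $ 1 - A 1 2 * c $ 2 + A 1 3 * c $ 3 - A 1 4 * c $ 4 = k ^ 2"
    and "A 2 1 * c $ 1 - A 2 2 * c $ 2 + A 2 3 * c $ 3 = 4 * u - 1"
    and "- 3 * (A 3 1 * c $ 1) + A 3 3 * c $ 3 = 4 * t - 1"
    and "A 4 1 * c $ 1 - A 4 2 * c $ 2 + A 4 3 * c $ 3 - A 4 4 * c $ 4 = a ^ 2"
    and "A 5 1 * c $ 1 - A 5 2 * c $ 2 + A 5 3 * c $ 3 = 4 * s - 1"
    and "- 3 * (A 6 1 * c $ 1) + A 6 3 * c $ 3 = 4 * r - 1"
proof -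
  have row: "(\<Sum>j\<in>UNIV. coefficient_matrix A $ i $ j * c $ j) = right_hand_side k a u t s r $ i" for i
    using assms by (simp add: matrix_vector_mult_def vec_eq_iff)
  note rows = row[unfolded coefficient_matrix_def right_hand_side_def sum_4]
  show "A 1 1 * c $ 1 - A 1 2 * c $ 2 + A 1 3 * c $ 3 - A 1 4 * c $ 4 = k ^ 2"
    using rows[of 1] by (simp add: vector_4_nth vector_6_nth)
  show "A 2 1 * c $ 1 - A 2 2 * c $ 2 + A 2 3 * c $ 3 = 4 * u - 1"
    using rows[of 2] by (simp add: vector_4_nth vector_6_nth)
  show "- 3 * (A 3 1 * c $ 1) + A 3 3 * c $ 3 = 4 * t - 1"
    using rows[of 3] by (simp add: vector_4_nth vector_6_nth)
  show "A 4 1 * c $ 1 - A 4 2 * c $ 2 + A 4 3 * c $ 3 - A 4 4 * c $ 4 = a ^ 2"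
    using rows[of 4] by (simp add: vector_4_nth vector_6_nth)
  show "A 5 1 * c $ 1 - A 5 2 * c $ 2 + A 5 3 * c $ 3 = 4 * s - 1"
    using rows[of 5] by (simp add: vector_4_nth vector_6_nth)
  show "- 3 * (A 6 1 * c $ 1) + A 6 3 * c $ 3 = 4 * r - 1"
    using rows[of 6] by (simp add: vector_4_nth vector_6_nth)
qed

theorem theorem11:
  fixes k a u t s r :: int
    and A :: "nat \<Rightarrow> nat \<Rightarrow> int"
    and N :: nat
    and sol :: "nat \<Rightarrow> int ^ 4"
  assumes "k \<ge> 1" and "odd k" and "a \<ge> 1" and "odd a"
    and "\<And>p :: int. prime p \<Longrightarrow> p dvd k \<or> p dvd a \<Longrightarrow> [p = 1] (mod 4)"
    and "A 1 1 = A 2 1" and "A 2 1 = A 3 1"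
    and "A 1 2 = A 2 2"
    and "A 1 3 = A 2 3" and "A 2 3 = A 3 3"
    and "A 4 1 = A 5 1" and "A 5 1 = A 6 1"
    and "A 4 2 = A 5 2"
    and "A 4 3 = A 5 3" and "A 5 3 = A 6 3"
    and "\<And>i. i \<in> {1..N} \<Longrightarrow> coefficient_matrix A *v sol i = right_hand_side k a u t s r"
  shows "\<forall>i\<in>{1..N}.
      \<not> (\<exists>x y :: int. x > 1 \<and> y \<ge> 1 \<and> (of_int x, of_int y) \<in> curve_E A (sol i)) \<and>
      \<not> (\<exists>x y :: int. x > 1 \<and> y \<ge> 1 \<and> (of_int x, of_int y) \<in> curve_C A (sol i))"
proof
  fix i assume "i \<in> {1..N}"
  then have sys: "coefficient_matrix A *v sol i = right_hand_side k a u t s r"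
    using assms(16) by blast
  note rows = linear_system_rows[OF sys]
  have good_k: "\<And>p :: int. prime p \<Longrightarrow> p dvd k \<Longrightarrow> [p = 1] (mod 4)"
    and good_a: "\<And>p :: int. prime p \<Longrightarrow> p dvd a \<Longrightarrow> [p = 1] (mod 4)"
    using assms(5) by blast+
  have "(of_int x, of_int y) \<notin> curve_E A (sol i)" if "x > 1" for x y :: int
    unfolding curve_E_def integer_point_on_affine_cubic_curve_iff
  proof (rule no_integer_point_on_cubic[OF \<open>odd k\<close> good_k rows(1)])
    show "A 1 1 * sol i $ 1 - A 1 2 * sol i $ 2 + A 1 3 * sol i $ 3 = 4 * u - 1"
      using rows(2) assms(6-10) by simp
    show "- 3 * (A 1 1 * sol i $ 1) + A 1 3 * sol i $ 3 = 4 * t - 1"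
      using rows(3) assms(6-10) by simp
    show "x > -1" using that by simp
  qed
  moreover have "(of_int x, of_int y) \<notin> curve_C A (sol i)" if "x > 1" for x y :: int
    unfolding curve_C_def integer_point_on_affine_cubic_curve_iff
  proof (rule no_integer_point_on_cubic[OF \<open>odd a\<close> good_a rows(4)])
    show "A 4 1 * sol i $ 1 - A 4 2 * sol i $ 2 + A 4 3 * sol i $ 3 = 4 * s - 1"
      using rows(5) assms(11-15) by simp
    show "- 3 * (A 4 1 * sol i $ 1) + A 4 3 * sol i $ 3 = 4 * r - 1"
      using rows(6) assms(11-15) by simp
    show "x > -1" using that by simp
  qed
  ultimately show "\<not> (\<exists>x y :: int. x > 1 \<and> y \<ge> 1 \<and> (of_int x, of_int y) \<in> curve_E A (sol i)) \<and>
      \<not> (\<exists>x y :: int. x > 1 \<and> y \<ge> 1 \<and> (of_int x, of_int y) \<in> curve_C A (sol i))"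
    by blast
qed

end
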